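(* Let $K$ be a field, $n\in\mathbb N$, $\Gamma$ an ordered abelian group, $\Gamma'$ an ordered abelian group containing $\Gamma$, and $\gamma\in\Gamma'$. Let $S$ be a subset of $K[x]$ closed under multiplication with $K[x]_n\subseteq S$, and let $q\in K[x]$ be a polynomial of degree $n$. Assume that $\mu:S\to\Gamma_\infty$ satisfies (V2) and that for every $\overline f,\overline g\in K[x]_n$ we have: (i) $\mu(\overline f\,\overline g)=\mu(\overline f)+\mu(\overline g)$; and (ii) if $\overline f\,\overline g=aq+c$ with $c\in K[x]_n$ (and consequently $a\in K[x]_n$), then $$\mu(c)=\mu(\overline f\,\overline g)<\mu(a)+\gamma .$$ Then the map $\mu':K[x]\to\Gamma'_\infty$ defined by $$\mu'(f)=\min_{0\le i\le r}\{\mu(f_i)+i\gamma\},$$ where $f=f_0+f_1q+\cdots+f_rq^r$ is the $q$-expansion of $f$, satisfies (V1) and (V2).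
   Context: For an ordered abelian group $\Gamma$, $\Gamma_\infty:=\Gamma\cup\{\infty\}$, where $\infty$ is a symbol not in $\Gamma$ and order and addition are extended from $\Gamma$ to $\Gamma_\infty$ in the obvious way. $K[x]_n:=\{p\in K[x]\mid \deg(p)<n\}$. For a polynomial $q$ of degree $n$, the $q$-expansion of $f\in K[x]$ is the unique expression $f=f_0+f_1q+\cdots+f_rq^r$ with all $f_i\in K[x]_n$. For a subset $T$ of a ring and a map $\mu$ from $T$ to $\Gamma_\infty$ (for an ordered abelian group $\Gamma$): (V1) for every $f,g\in T$, if $fg\in T$, then $\mu(fg)=\mu(f)+\mu(g)$; (V2) for every $f,g\in T$, if $f+g\in T$, then $\mu(f+g)\geq\min\{\mu(f),\mu(g)\}$. *)

theory Defs
  imports "HOL-Computational_Algebra.Polynomial"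
begin

datatype 'g with_infty = Fin 'g | Infty

instantiation with_infty :: (linorder) linorder
begin

fun less_eq_with_infty :: "'a with_infty \<Rightarrow> 'a with_infty \<Rightarrow> bool" where
  "less_eq_with_infty _ Infty = True"
| "less_eq_with_infty Infty (Fin _) = False"
| "less_eq_with_infty (Fin a) (Fin b) = (a \<le> b)"

definition less_with_infty :: "'a with_infty \<Rightarrow> 'a with_infty \<Rightarrow> bool" where
  "less_with_infty u v \<longleftrightarrow> u \<le> v \<and> \<not> v \<le> u"

instance
proof
  fix u v w :: "'a with_infty"
  show "u < v \<longleftrightarrow> u \<le> v \<and> \<not> v \<le> u"
    by (simp add: less_with_infty_def)
  show "u \<le> u"
    by (cases u) auto
  show "u \<le> v \<Longrightarrow> v \<le> w \<Longrightarrow> u \<le> w"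
    by (cases u; cases v; cases w) auto
  show "u \<le> v \<Longrightarrow> v \<le> u \<Longrightarrow> u = v"
    by (cases u; cases v) auto
  show "u \<le> v \<or> v \<le> u"
    by (cases u; cases v) auto
qed

end

lemma less_with_infty_simps [simp]:
  fixes a b :: "'a::linorder"
  shows "Fin a < Fin b \<longleftrightarrow> a < b"
    and "Fin a < Infty"
    and "\<not> Infty < u"
  by (auto simp: less_with_infty_def not_le)

instantiation with_infty :: (comm_monoid_add) comm_monoid_add
begin

fun plus_with_infty :: "'a with_infty \<Rightarrow> 'a with_infty \<Rightarrow> 'a with_infty" where
  "plus_with_infty (Fin a) (Fin b) = Fin (a + b)"
| "plus_with_infty Infty _ = Infty"
| "plus_with_infty (Fin _) Infty = Infty"

definition zero_with_infty :: "'a with_infty" where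
  "zero_with_infty = Fin 0"

instance
proof
  fix u v w :: "'a with_infty"
  show "u + v + w = u + (v + w)"
    by (cases u; cases v; cases w) (auto simp: add.assoc)
  show "u + v = v + u"
    by (cases u; cases v) (auto simp: add.commute)
  show "0 + u = u"
    by (cases u) (auto simp: zero_with_infty_def)
qed

end

definition add_subgroup :: "'g::ab_group_add set \<Rightarrow> bool" where
  "add_subgroup G \<longleftrightarrow>
     0 \<in> G \<and> (\<forall>a\<in>G. \<forall>b\<in>G. a + b \<in> G) \<and> (\<forall>a\<in>G. - a \<in> G)"

definition adjoin_infty :: "'g set \<Rightarrow> 'g with_infty set" where
  "adjoin_infty G = insert Infty (Fin ` G)"

definition V1 :: "'r::ring set \<Rightarrow> ('r \<Rightarrow> 'g::linordered_ab_group_add with_infty) \<Rightarrow> bool" where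
  "V1 T \<mu> \<longleftrightarrow> (\<forall>f\<in>T. \<forall>g\<in>T. f * g \<in> T \<longrightarrow> \<mu> (f * g) = \<mu> f + \<mu> g)"

definition V2 :: "'r::ring set \<Rightarrow> ('r \<Rightarrow> 'g::linordered_ab_group_add with_infty) \<Rightarrow> bool" where
  "V2 T \<mu> \<longleftrightarrow> (\<forall>f\<in>T. \<forall>g\<in>T. f + g \<in> T \<longrightarrow> \<mu> (f + g) \<ge> min (\<mu> f) (\<mu> g))"

text \<open>The zero polynomial is listed separately because the library sets its degree to 0.\<close>

definition polys_below :: "nat \<Rightarrow> 'k::field poly set" where
  "polys_below n = {p. p = 0 \<or> degree p < n}"

text \<open>
  The sequence of coefficients \<open>f\<^sub>0, \<dots>, f\<^sub>r\<close> of an expansion is encoded as a polynomial \<open>F\<close>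
  over \<open>K[x]\<close>, with \<open>f\<^sub>i = coeff F i\<close> and \<open>r = degree F\<close>. This rules out vanishing leading
  coefficients (for \<open>f = 0\<close> one has \<open>r = 0\<close> and \<open>f\<^sub>0 = 0\<close>), so that the expansion is unique.
\<close>

definition is_q_expansion :: "'k::field poly \<Rightarrow> 'k poly \<Rightarrow> 'k poly poly \<Rightarrow> bool" where
  "is_q_expansion q f F \<longleftrightarrow>
     (\<forall>i. coeff F i \<in> polys_below (degree q)) \<and>
     f = (\<Sum>i\<le>degree F. coeff F i * q ^ i)"

definition q_expansion :: "'k::field poly \<Rightarrow> 'k poly \<Rightarrow> 'k poly poly" where
  "q_expansion q f = (THE F. is_q_expansion q f F)"

lemma is_q_expansion_altdef:
  "is_q_expansion q f F \<longleftrightarrow>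
     (\<forall>i. coeff F i \<in> polys_below (degree q)) \<and> poly F q = f"
  by (auto simp: is_q_expansion_def poly_altdef)

lemma q_expansion_exists:
  fixes q f :: "'k::field poly"
  assumes "degree q > 0"
  shows "\<exists>F. is_q_expansion q f F"
proof (induction "degree f" arbitrary: f rule: less_induct)
  case less
  show ?case
  proof (cases "degree f < degree q")
    case True
    then have "is_q_expansion q f [:f:]"
      by (auto simp: is_q_expansion_altdef polys_below_def coeff_pCons split: nat.split)
    then show ?thesis ..
  next
    case False
    have q: "q \<noteq> 0" using assms by auto
    have "degree (f div q) < degree f"
    proof (cases "f div q = 0")
      case True
      then show ?thesis using False assms by simp
    next
      case nz: False
      have "degree (f mod q) < degree q"
        using degree_mod_less[OF q, of f] assms by auto
      then have "degree (f - f mod q) \<le> degree f"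
        using False by (intro degree_diff_le) auto
      moreover have "f - f mod q = f div q * q"
        by (simp add: minus_mod_eq_div_mult)
      ultimately show ?thesis
        using nz q assms by (simp add: degree_mult_eq)
    qed
    then obtain F where F: "is_q_expansion q (f div q) F"
      using less by blast
    have "f mod q \<in> polys_below (degree q)"
      using degree_mod_less[OF q, of f] by (auto simp: polys_below_def)
    moreover have "f mod q + q * (f div q) = f"
      by simp
    ultimately have "is_q_expansion q f (pCons (f mod q) F)"
      using F by (auto simp: is_q_expansion_altdef coeff_pCons split: nat.split)
    then show ?thesis ..
  qed
qed

lemma q_expansion_unique:
  fixes q f :: "'k::field poly"
  assumes "degree q > 0" "is_q_expansion q f F" "is_q_expansion q f G"
  shows "F = G"
proof -
  have q: "q \<noteq> 0" using assms(1) by auto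
  have small: "a mod q = a" if "a \<in> polys_below (degree q)" for a
    using that by (auto simp: polys_below_def mod_poly_less)
  have "F = G"
    if "\<forall>i. coeff F i \<in> polys_below (degree q)" "\<forall>i. coeff G i \<in> polys_below (degree q)"
       "poly F q = poly G q" for F G
    using that
  proof (induction F G rule: poly_induct2)
    case 0
    then show ?case by simp
  next
    case (pCons a F b G)
    have c: "a \<in> polys_below (degree q)" "b \<in> polys_below (degree q)"
      using pCons.prems(1,2)[THEN spec, of 0] by auto
    have cc: "\<forall>i. coeff F i \<in> polys_below (degree q)" "\<forall>i. coeff G i \<in> polys_below (degree q)"
      using pCons.prems(1,2)[THEN spec, of "Suc i" for i] by auto
    have e: "a + q * poly F q = b + q * poly G q"
      using pCons.prems(3) by simp
    then have "(a + q * poly F q) mod q = (b + q * poly G q) mod q" by simp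
    then have "a = b" using c by (simp add: small)
    then show ?case using e q cc pCons.IH by simp
  qed
  then show ?thesis using assms(2,3) by (simp add: is_q_expansion_altdef)
qed

lemma is_q_expansion_q_expansion:
  assumes "degree q > 0"
  shows "is_q_expansion q f (q_expansion q f)"
  unfolding q_expansion_def
  by (rule theI') (use q_expansion_exists[OF assms] q_expansion_unique[OF assms] in blast)

text \<open>The sum in the second argument is the \<open>i\<close>-fold sum \<open>i\<gamma>\<close>.\<close>

definition mu' :: "('k::field poly \<Rightarrow> 'g::linordered_ab_group_add with_infty)
    \<Rightarrow> 'k poly \<Rightarrow> 'g \<Rightarrow> 'k poly \<Rightarrow> 'g with_infty" where
  "mu' \<mu> q \<gamma> f =
     Min ((\<lambda>i. \<mu> (coeff (q_expansion q f) i) + Fin (\<Sum>j<i. \<gamma>)) ` {..degree (q_expansion q f)})"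

end

theory Submission
  imports Defs
begin

text \<open>
  Write \<open>f\<close> and \<open>g\<close> as polynomials \<open>F\<close>, \<open>G\<close> in a new variable that is later specialised to \<open>q\<close>.
  The product \<open>F G\<close> specialises to \<open>f g\<close>, but its coefficients are too large to form a
  \<open>q\<close>-expansion. Reducing each of them modulo \<open>q\<close> and carrying the quotient to the next place
  repairs this, and one round of carrying suffices since a sum of products of two polynomials
  of degree less than \<open>n\<close> has a quotient by \<open>q\<close> of degree less than \<open>n\<close>. So the \<open>k\<close>-th
  coefficient of the expansion of \<open>f g\<close> is a sum of remainders of \<open>f\<^sub>i g\<^sub>j\<close> with \<open>i + j = k\<close>
  and of quotients of \<open>f\<^sub>i g\<^sub>j\<close> with \<open>i + j + 1 = k\<close> (\<open>is_q_expansion_mult\<close>).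

  Hypothesis (ii) says that in passing from \<open>f\<^sub>i g\<^sub>j q\<^sup>i\<^sup>+\<^sup>j\<close> to its expansion the remainder term
  keeps the value, while the carried term has strictly larger value. By (V2) every term of the
  expansion of \<open>f g\<close> therefore has value at least \<open>\<mu>'(f) + \<mu>'(g)\<close>. For the converse, let \<open>i\<^sub>0\<close> and
  \<open>j\<^sub>0\<close> be the least indices at which the minima defining \<open>\<mu>'(f)\<close> and \<open>\<mu>'(g)\<close> are attained. Among
  all contributions at place \<open>i\<^sub>0 + j\<^sub>0\<close> the remainder of \<open>f\<^sub>i\<^sub>0 g\<^sub>j\<^sub>0\<close> is the only one of minimal
  value: the carried ones are strictly larger by (ii), and any other pair with \<open>i + j = i\<^sub>0 + j\<^sub>0\<close>
  has \<open>i < i\<^sub>0\<close> or \<open>j < j\<^sub>0\<close>. Hence the sum at this place has exactly the value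
  \<open>\<mu>'(f) + \<mu>'(g)\<close> (\<open>V1_mu'\<close>).

  The argument uses \<open>\<mu>(0) = \<infinity>\<close>, which the hypotheses do not force. The only alternative is that
  \<open>\<mu>\<close> vanishes identically on \<open>K[x]\<^sub>n\<close> and \<open>\<gamma> > 0\<close>; then \<open>\<mu>'\<close> is identically \<open>0\<close>
  (\<open>mu'_eq_zero\<close>).
\<close>

section \<open>Ordered groups with infinity\<close>

lemma plus_Infty_right [simp]: "u + Infty = Infty"
  by (cases u) auto

lemma plus_Fin_mono:
  fixes b :: "'g::linordered_ab_group_add"
  shows "u \<le> v \<Longrightarrow> u + Fin b \<le> v + Fin b"
  by (cases u; cases v) auto

lemma Fin_le_plus_Fin_iff:
  fixes a b :: "'g::linordered_ab_group_add"
  shows "Fin a \<le> u + Fin b \<longleftrightarrow> Fin (a - b) \<le> u"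
  by (cases u) (auto simp: algebra_simps)

lemma Fin_less_plus_Fin_iff:
  fixes a b :: "'g::linordered_ab_group_add"
  shows "Fin a < u + Fin b \<longleftrightarrow> Fin (a - b) < u"
  by (cases u) (auto simp: algebra_simps)

lemma Fin_eq_plus_Fin_iff:
  fixes a b :: "'g::linordered_ab_group_add"
  shows "u + Fin b = Fin a \<longleftrightarrow> u = Fin (a - b)"
  by (cases u) (auto simp: algebra_simps)

lemma Fin_add_le:
  fixes a b :: "'g::linordered_ab_group_add"
  assumes "Fin a \<le> u" "Fin b \<le> v"
  shows "Fin (a + b) \<le> u + v"
  using assms by (cases u; cases v) (auto intro: add_mono)

lemma Fin_add_less:
  fixes a b :: "'g::linordered_ab_group_add"
  assumes "Fin a \<le> u" "Fin b \<le> v" "Fin a < u \<or> Fin b < v"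
  shows "Fin (a + b) < u + v"
  using assms by (cases u; cases v) (auto intro: add_less_le_mono add_le_less_mono)

lemma sum_lessThan_const_add:
  fixes \<gamma> :: "'g::ab_group_add" and i j :: nat
  shows "(\<Sum>l<i + j. \<gamma>) = (\<Sum>l<i. \<gamma>) + (\<Sum>l<j. \<gamma>)"
  by (induction j) (auto simp: algebra_simps)

section \<open>Expansion of a product\<close>

lemma polys_below_iff:
  "d > 0 \<Longrightarrow> p \<in> polys_below d \<longleftrightarrow> degree p < d"
  by (auto simp: polys_below_def)

lemma zero_mem_polys_below: "0 \<in> polys_below d"
  by (simp add: polys_below_def)

lemma polys_below_add: "a \<in> polys_below d \<Longrightarrow> b \<in> polys_below d \<Longrightarrow> a + b \<in> polys_below d"
  using degree_add_less[of a d b] by (cases "a = 0"; cases "b = 0") (auto simp: polys_below_def)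

lemma polys_below_sum: "(\<And>i. i \<in> A \<Longrightarrow> h i \<in> polys_below d) \<Longrightarrow> sum h A \<in> polys_below d"
  by (induction A rule: infinite_finite_induct) (simp_all add: polys_below_add zero_mem_polys_below)

lemma mod_mem_polys_below: "degree q > 0 \<Longrightarrow> a mod q \<in> polys_below (degree q)"
  using degree_mod_less[of q a] by (cases "q = 0") (auto simp: polys_below_def)

lemma div_mult_mem_polys_below:
  assumes "degree q > 0" "a \<in> polys_below (degree q)" "b \<in> polys_below (degree q)"
  shows "(a * b) div q \<in> polys_below (degree q)"
proof -
  have "degree (a * b div q) < degree q"
  proof (cases "a * b div q = 0")
    case False
    have "degree (a * b div q) + degree q = degree (a * b div q * q)"
      using assms(1) False by (subst degree_mult_eq) auto
    also have "a * b div q * q = a * b - a * b mod q"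
      by (simp add: minus_mod_eq_div_mult)
    also have "degree \<dots> < degree q + degree q"
    proof (rule degree_diff_less)
      show "degree (a * b) < degree q + degree q"
        using degree_mult_le[of a b] assms by (simp add: polys_below_iff)
      show "degree (a * b mod q) < degree q + degree q"
        using mod_mem_polys_below[OF assms(1), of "a * b"] assms(1) by (simp add: polys_below_iff)
    qed
    finally show ?thesis by simp
  qed (use assms(1) in simp)
  then show ?thesis
    using assms(1) by (simp add: polys_below_iff)
qed

lemma mod_poly_sum: "(sum h A :: 'k::field poly) mod q = (\<Sum>i\<in>A. h i mod q)"
  by (induction A rule: infinite_finite_induct) (auto simp: poly_mod_add_left)

lemma div_poly_sum: "(sum h A :: 'k::field poly) div q = (\<Sum>i\<in>A. h i div q)"
  by (induction A rule: infinite_finite_induct) (auto simp: poly_div_add_left)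

lemma q_expansion_eqI: "degree q > 0 \<Longrightarrow> is_q_expansion q f F \<Longrightarrow> q_expansion q f = F"
  using q_expansion_unique is_q_expansion_q_expansion by blast

lemma is_q_expansion_add:
  "is_q_expansion q f F \<Longrightarrow> is_q_expansion q g G \<Longrightarrow> is_q_expansion q (f + g) (F + G)"
  by (auto simp: is_q_expansion_altdef polys_below_add)

text \<open>
  As in positional notation to the base \<open>q\<close>: the shift by one place is a factor \<open>q\<close> after
  specialisation, so the value at \<open>q\<close> does not change.
\<close>

definition carry :: "'k::field poly \<Rightarrow> 'k poly poly \<Rightarrow> 'k poly poly" where
  "carry q P = map_poly (\<lambda>a. a mod q) P + pCons 0 (map_poly (\<lambda>a. a div q) P)"

lemma poly_carry: "poly (carry q P) q = poly P q"
proof (induction P)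
  case 0
  show ?case by (simp add: carry_def)
next
  case (pCons a P)
  have "poly (carry q (pCons a P)) q = a mod q + q * (a div q) + q * poly (carry q P) q"
    by (simp add: carry_def map_poly_pCons algebra_simps)
  then show ?case
    by (simp add: pCons.IH)
qed

lemma coeff_carry:
  "coeff (carry q (F * G)) k =
     (\<Sum>i\<le>k. coeff F i * coeff G (k - i) mod q) +
     (\<Sum>i<k. coeff F i * coeff G (k - 1 - i) div q)"
proof (cases k)
  case 0
  then show ?thesis by (simp add: carry_def coeff_map_poly coeff_mult)
next
  case (Suc m)
  have "coeff (carry q (F * G)) k = coeff (F * G) k mod q + coeff (F * G) m div q"
    by (simp add: carry_def coeff_map_poly Suc)
  then show ?thesis
    by (simp only: coeff_mult mod_poly_sum div_poly_sum Suc lessThan_Suc_atMost diff_Suc_1)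
qed

lemma is_q_expansion_mult:
  assumes "degree q > 0" "is_q_expansion q f F" "is_q_expansion q g G"
  shows "is_q_expansion q (f * g) (carry q (F * G))"
proof -
  have "coeff F i \<in> polys_below (degree q)" "coeff G i \<in> polys_below (degree q)" for i
    using assms by (auto simp: is_q_expansion_altdef)
  then show ?thesis
    using assms unfolding is_q_expansion_altdef coeff_carry poly_carry
    by (auto intro!: polys_below_add polys_below_sum mod_mem_polys_below div_mult_mem_polys_below)
qed

section \<open>Values on small polynomials\<close>

text \<open>
  The part of the hypotheses that concerns \<open>K[x]\<^sub>n\<close>, with the division \<open>f g = a q + c\<close> written
  through quotient and remainder, in the case \<open>\<mu>(0) = \<infinity>\<close>.
\<close>

locale partial_valuation =
  fixes \<mu> :: "'k::field poly \<Rightarrow> 'g::linordered_ab_group_add with_infty"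
    and q :: "'k poly" and \<gamma> :: 'g
  assumes degree_q: "degree q > 0"
    and mu_0: "\<mu> 0 = Infty"
    and mu_add: "\<lbrakk>f \<in> polys_below (degree q); g \<in> polys_below (degree q)\<rbrakk>
                  \<Longrightarrow> min (\<mu> f) (\<mu> g) \<le> \<mu> (f + g)"
    and mu_mult: "\<lbrakk>f \<in> polys_below (degree q); g \<in> polys_below (degree q)\<rbrakk>
                  \<Longrightarrow> \<mu> (f * g) = \<mu> f + \<mu> g"
    and mu_mod: "\<lbrakk>f \<in> polys_below (degree q); g \<in> polys_below (degree q)\<rbrakk>
                  \<Longrightarrow> \<mu> (f * g mod q) = \<mu> (f * g)"
    and mu_less_div: "\<lbrakk>f \<in> polys_below (degree q); g \<in> polys_below (degree q); f \<noteq> 0; g \<noteq> 0\<rbrakk>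
                  \<Longrightarrow> \<mu> (f * g) < \<mu> (f * g div q) + Fin \<gamma>"
begin

abbreviation "B \<equiv> polys_below (degree q)"

lemma one_mem_B: "1 \<in> B"
  and minus_mem_B: "f \<in> B \<Longrightarrow> - f \<in> B"
  using degree_q by (auto simp: polys_below_def)

text \<open>
  Finiteness comes from the strict inequality in (ii): for the product \<open>1 \<cdot> f\<close> the quotient is \<open>0\<close>,
  so \<open>\<mu>(f)\<close> lies strictly below \<open>\<mu>(0) + \<gamma> = \<infinity>\<close>.
\<close>

lemma mu_eq_Infty_iff:
  assumes "f \<in> B"
  shows "\<mu> f = Infty \<longleftrightarrow> f = 0"
proof
  assume "\<mu> f = Infty"
  then show "f = 0"
    using mu_less_div[OF one_mem_B assms] by auto
qed (simp add: mu_0)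

lemma mu_minus:
  assumes "f \<in> B"
  shows "\<mu> (- f) = \<mu> f"
proof -
  have one: "\<mu> 1 = Fin 0"
    using mu_mult[OF one_mem_B one_mem_B] mu_eq_Infty_iff[OF one_mem_B] by (cases "\<mu> 1") auto
  have "\<mu> (-1) + \<mu> (-1) = Fin 0"
    using mu_mult[OF minus_mem_B minus_mem_B, OF one_mem_B one_mem_B] one by simp
  then have "\<mu> (-1) = Fin 0"
    by (cases "\<mu> (-1)") auto
  then show ?thesis
    using mu_mult[OF minus_mem_B[OF one_mem_B] assms] by (cases "\<mu> f") auto
qed

lemma le_mu_sum:
  assumes "\<And>i. i \<in> A \<Longrightarrow> h i \<in> B" "\<And>i. i \<in> A \<Longrightarrow> v \<le> \<mu> (h i)"
  shows "v \<le> \<mu> (sum h A)"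
  using assms
proof (induction A rule: infinite_finite_induct)
  case (insert i A)
  then have "v \<le> min (\<mu> (h i)) (\<mu> (sum h A))" by auto
  also have "\<dots> \<le> \<mu> (h i + sum h A)"
    using insert.prems by (intro mu_add polys_below_sum) auto
  finally show ?case using insert.hyps by simp
qed (simp_all add: mu_0)

lemma less_mu_sum:
  assumes "\<And>i. i \<in> A \<Longrightarrow> h i \<in> B" "\<And>i. i \<in> A \<Longrightarrow> Fin v < \<mu> (h i)"
  shows "Fin v < \<mu> (sum h A)"
  using assms
proof (induction A rule: infinite_finite_induct)
  case (insert i A)
  then have "Fin v < min (\<mu> (h i)) (\<mu> (sum h A))" by auto
  also have "\<dots> \<le> \<mu> (h i + sum h A)"
    using insert.prems by (intro mu_add polys_below_sum) auto
  finally show ?case using insert.hyps by simp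
qed (simp_all add: mu_0)

text \<open>
  A summand of strictly larger value does not change the value: otherwise subtracting it again would
  violate (V2).
\<close>

lemma mu_add_eq_of_less:
  assumes "f \<in> B" "g \<in> B" "\<mu> f < \<mu> g"
  shows "\<mu> (f + g) = \<mu> f"
proof (rule antisym)
  show "\<mu> f \<le> \<mu> (f + g)"
    using mu_add[OF assms(1,2)] assms(3) by (simp add: min_absorb1)
  have "min (\<mu> (f + g)) (\<mu> (- g)) \<le> \<mu> (f + g + - g)"
    using assms by (intro mu_add polys_below_add minus_mem_B)
  then have "min (\<mu> (f + g)) (\<mu> g) \<le> \<mu> f"
    using assms(2) by (simp add: mu_minus)
  then show "\<mu> (f + g) \<le> \<mu> f"
    using assms(3) by (auto simp: min_le_iff_disj)
qed

section \<open>The extended map\<close>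

text \<open>
  Every index may be taken, also beyond the length of the expansion, since the vanishing
  coefficients there have value \<open>\<infinity>\<close>. This makes expansions of different lengths comparable.
\<close>

lemma le_mu'_iff:
  assumes "is_q_expansion q f F"
  shows "v \<le> mu' \<mu> q \<gamma> f \<longleftrightarrow> (\<forall>i. v \<le> \<mu> (coeff F i) + Fin (\<Sum>l<i. \<gamma>))"
proof -
  have "v \<le> \<mu> (coeff F i) + Fin (\<Sum>l<i. \<gamma>)" if "i \<notin> {..degree F}" for i
    using that by (simp add: coeff_eq_0 mu_0)
  then show ?thesis
    unfolding mu'_def q_expansion_eqI[OF degree_q assms]
    by (subst Min_ge_iff) (auto simp del: atMost_iff)
qed

lemma mu'_attained:
  assumes "is_q_expansion q f F"
  obtains i where "\<mu> (coeff F i) + Fin (\<Sum>l<i. \<gamma>) = mu' \<mu> q \<gamma> f"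
proof -
  let ?T = "(\<lambda>i. \<mu> (coeff F i) + Fin (\<Sum>l<i. \<gamma>)) ` {..degree F}"
  have "Min ?T \<in> ?T" by (rule Min_in) auto
  then obtain i where "Min ?T = \<mu> (coeff F i) + Fin (\<Sum>l<i. \<gamma>)"
    by (rule imageE)
  then show thesis
    using that[of i] by (simp only: mu'_def q_expansion_eqI[OF degree_q assms])
qed

lemma mu'_eq_Infty_iff: "mu' \<mu> q \<gamma> f = Infty \<longleftrightarrow> f = 0"
proof -
  obtain F where F: "is_q_expansion q f F"
    using q_expansion_exists[OF degree_q] by blast
  have "mu' \<mu> q \<gamma> f = Infty \<longleftrightarrow> Infty \<le> mu' \<mu> q \<gamma> f"
    by (cases "mu' \<mu> q \<gamma> f") auto
  also have "\<dots> \<longleftrightarrow> (\<forall>i. \<mu> (coeff F i) = Infty)"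
    unfolding le_mu'_iff[OF F]
  proof (rule arg_cong[where f = All], rule ext)
    fix i
    show "Infty \<le> \<mu> (coeff F i) + Fin (\<Sum>l<i. \<gamma>) \<longleftrightarrow> \<mu> (coeff F i) = Infty"
      by (cases "\<mu> (coeff F i)") auto
  qed
  also have "\<dots> \<longleftrightarrow> F = 0"
    using F by (auto simp: is_q_expansion_altdef mu_eq_Infty_iff poly_eq_iff)
  also have "\<dots> \<longleftrightarrow> f = 0"
    using F q_expansion_unique[OF degree_q, of 0 F 0]
    by (auto simp: is_q_expansion_altdef polys_below_def)
  finally show ?thesis .
qed

lemma V2_mu': "V2 UNIV (mu' \<mu> q \<gamma>)"
  unfolding V2_def
proof (intro ballI impI)
  fix f g :: "'k poly"
  obtain F G where F: "is_q_expansion q f F" and G: "is_q_expansion q g G"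
    using q_expansion_exists[OF degree_q] by blast
  let ?v = "min (mu' \<mu> q \<gamma> f) (mu' \<mu> q \<gamma> g)"
  show "?v \<le> mu' \<mu> q \<gamma> (f + g)"
    unfolding le_mu'_iff[OF is_q_expansion_add[OF F G]]
  proof
    fix i
    have "?v \<le> \<mu> (coeff F i) + Fin (\<Sum>l<i. \<gamma>)" "?v \<le> \<mu> (coeff G i) + Fin (\<Sum>l<i. \<gamma>)"
      using le_mu'_iff[OF F, of "mu' \<mu> q \<gamma> f"] le_mu'_iff[OF G, of "mu' \<mu> q \<gamma> g"]
      by (auto simp: min_le_iff_disj)
    moreover have "min (\<mu> (coeff F i)) (\<mu> (coeff G i)) \<le> \<mu> (coeff (F + G) i)"
      using F G mu_add by (auto simp: is_q_expansion_altdef)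
    ultimately show "?v \<le> \<mu> (coeff (F + G) i) + Fin (\<Sum>l<i. \<gamma>)"
      by (auto simp only: min_le_iff_disj[of _ _ "\<mu> (coeff (F + G) i)"]
               intro: order_trans plus_Fin_mono)
  qed
qed

lemma V1_mu': "V1 UNIV (mu' \<mu> q \<gamma>)"
  unfolding V1_def
proof (intro ballI impI)
  fix f g :: "'k poly"
  show "mu' \<mu> q \<gamma> (f * g) = mu' \<mu> q \<gamma> f + mu' \<mu> q \<gamma> g"
  proof (cases "f = 0 \<or> g = 0")
    case True
    then show ?thesis using mu'_eq_Infty_iff[of 0] by auto
  next
    case False
    obtain F G where F: "is_q_expansion q f F" and G: "is_q_expansion q g G"
      using q_expansion_exists[OF degree_q] by blast
    obtain u w where u: "mu' \<mu> q \<gamma> f = Fin u" and w: "mu' \<mu> q \<gamma> g = Fin w"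
      using False mu'_eq_Infty_iff by (metis with_infty.exhaust)
    define s where "s i = (\<Sum>l<i. \<gamma>)" for i :: nat
    have s_add: "s (i + j) = s i + s j" and s_1: "s (Suc 0) = \<gamma>" for i j
      by (simp_all add: s_def sum_lessThan_const_add)
    have FB: "coeff F i \<in> B" and GB: "coeff G i \<in> B" for i
      using F G by (auto simp: is_q_expansion_altdef)
    have uF: "Fin (u - s i) \<le> \<mu> (coeff F i)" and wG: "Fin (w - s i) \<le> \<mu> (coeff G i)" for i
      using le_mu'_iff[OF F, of "Fin u"] le_mu'_iff[OF G, of "Fin w"] u w
      by (auto simp: Fin_le_plus_Fin_iff s_def)
    define i0 where "i0 = (LEAST i. \<mu> (coeff F i) = Fin (u - s i))"
    define j0 where "j0 = (LEAST j. \<mu> (coeff G j) = Fin (w - s j))"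
    have i0: "\<mu> (coeff F i0) = Fin (u - s i0)"
      unfolding i0_def using mu'_attained[OF F] u
      by (metis (mono_tags, lifting) LeastI Fin_eq_plus_Fin_iff s_def)
    have j0: "\<mu> (coeff G j0) = Fin (w - s j0)"
      unfolding j0_def using mu'_attained[OF G] w
      by (metis (mono_tags, lifting) LeastI Fin_eq_plus_Fin_iff s_def)
    have uF_less: "Fin (u - s i) < \<mu> (coeff F i)" if "i < i0" for i
      using not_less_Least[OF that[unfolded i0_def]] uF[of i] by auto
    have wG_less: "Fin (w - s j) < \<mu> (coeff G j)" if "j < j0" for j
      using not_less_Least[OF that[unfolded j0_def]] wG[of j] by auto

    \<comment> \<open>The value that a coefficient at place \<open>k\<close> must have to give a term of value \<open>u + w\<close>.\<close>
    define b where "b k = u + w - s k" for k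
    have b_add: "b (i + j) = (u - s i) + (w - s j)" for i j
      by (simp add: b_def s_add algebra_simps)
    have mod_eq: "\<mu> (coeff F i * coeff G j mod q) = \<mu> (coeff F i) + \<mu> (coeff G j)" for i j
      by (simp add: mu_mod mu_mult FB GB)
    have mod_ge: "Fin (b (i + j)) \<le> \<mu> (coeff F i * coeff G j mod q)" for i j
      unfolding mod_eq b_add by (intro Fin_add_le uF wG)
    have mod_less: "Fin (b (i + j)) < \<mu> (coeff F i * coeff G j mod q)"
      if "i < i0 \<or> j < j0" for i j
      unfolding mod_eq b_add using that by (intro Fin_add_less uF wG) (auto intro: uF_less wG_less)
    have div_less: "Fin (b (Suc (i + j))) < \<mu> (coeff F i * coeff G j div q)" for i j
    proof (cases "coeff F i = 0 \<or> coeff G j = 0")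
      case True
      then show ?thesis by (auto simp: mu_0)
    next
      case False
      have "Fin (b (i + j)) \<le> \<mu> (coeff F i) + \<mu> (coeff G j)"
        unfolding b_add by (intro Fin_add_le uF wG)
      also have "\<dots> < \<mu> (coeff F i * coeff G j div q) + Fin \<gamma>"
        using mu_less_div[OF FB GB] False by (simp add: mu_mult FB GB)
      finally show ?thesis
        using s_add[of "i + j" 1] by (simp add: Fin_less_plus_Fin_iff b_def s_1 diff_diff_eq)
    qed
    have modB: "coeff F i * coeff G j mod q \<in> B" and divB: "coeff F i * coeff G j div q \<in> B" for i j
      using degree_q FB GB by (auto intro: mod_mem_polys_below div_mult_mem_polys_below)

    define H where "H = carry q (F * G)"
    have H: "is_q_expansion q (f * g) H"
      unfolding H_def by (rule is_q_expansion_mult[OF degree_q F G])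
    define M where "M k = (\<Sum>i\<le>k. coeff F i * coeff G (k - i) mod q)" for k
    define D where "D k = (\<Sum>i<k. coeff F i * coeff G (k - 1 - i) div q)" for k
    have H_eq: "coeff H k = M k + D k" for k
      unfolding H_def M_def D_def by (rule coeff_carry)
    have MB: "M k \<in> B" and DB: "D k \<in> B" for k
      unfolding M_def D_def by (auto intro!: polys_below_sum modB divB)
    have D_less: "Fin (b k) < \<mu> (D k)" for k
      unfolding D_def
    proof (rule less_mu_sum)
      fix i assume "i \<in> {..<k}"
      then show "Fin (b k) < \<mu> (coeff F i * coeff G (k - 1 - i) div q)"
        using div_less[of i "k - 1 - i"] by simp
    qed (rule divB)
    have M_ge: "Fin (b k) \<le> \<mu> (M k)" for k
      unfolding M_def
    proof (rule le_mu_sum)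
      fix i assume "i \<in> {..k}"
      then show "Fin (b k) \<le> \<mu> (coeff F i * coeff G (k - i) mod q)"
        using mod_ge[of i "k - i"] by simp
    qed (rule modB)

    have "Fin (u + w) \<le> mu' \<mu> q \<gamma> (f * g)"
      unfolding le_mu'_iff[OF H]
    proof
      fix k
      have "Fin (b k) \<le> min (\<mu> (M k)) (\<mu> (D k))"
        using M_ge D_less by (simp add: less_imp_le)
      also have "\<dots> \<le> \<mu> (coeff H k)"
        unfolding H_eq by (rule mu_add[OF MB DB])
      finally show "Fin (u + w) \<le> \<mu> (coeff H k) + Fin (\<Sum>l<k. \<gamma>)"
        by (simp add: Fin_le_plus_Fin_iff b_def s_def)
    qed
    moreover have "mu' \<mu> q \<gamma> (f * g) \<le> Fin (u + w)"
    proof -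
      let ?k = "i0 + j0"
      let ?h = "\<lambda>i. coeff F i * coeff G (?k - i) mod q"
      have top: "\<mu> (?h i0) = Fin (b ?k)"
        by (simp add: mod_eq i0 j0 b_add)
      have rest: "Fin (b ?k) < \<mu> (sum ?h ({..?k} - {i0}))"
      proof (rule less_mu_sum)
        fix i assume "i \<in> {..?k} - {i0}"
        then have "i < i0 \<or> ?k - i < j0" "i + (?k - i) = ?k" by auto
        then show "Fin (b ?k) < \<mu> (?h i)"
          using mod_less[of i "?k - i"] by simp
      qed (rule modB)
      have "M ?k = ?h i0 + sum ?h ({..?k} - {i0})"
        unfolding M_def by (rule sum.remove) auto
      moreover have "\<mu> (?h i0 + sum ?h ({..?k} - {i0})) = \<mu> (?h i0)"
        by (rule mu_add_eq_of_less, rule modB, rule polys_below_sum, rule modB)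
           (use rest in \<open>simp only: top\<close>)
      ultimately have "\<mu> (M ?k) = Fin (b ?k)"
        by (simp only: top)
      then have "\<mu> (coeff H ?k) = Fin (b ?k)"
        using mu_add_eq_of_less[OF MB DB] D_less[of ?k] by (simp add: H_eq)
      moreover have "mu' \<mu> q \<gamma> (f * g) \<le> \<mu> (coeff H ?k) + Fin (s ?k)"
        using le_mu'_iff[OF H, of "mu' \<mu> q \<gamma> (f * g)"] by (simp add: s_def)
      ultimately show ?thesis by (simp add: b_def)
    qed
    ultimately show ?thesis by (simp add: u w)
  qed
qed

end

section \<open>The degenerate case\<close>

lemma mu'_eq_zero:
  fixes \<gamma> :: "'g::linordered_ab_group_add"
  assumes "degree q > 0" "\<And>f. f \<in> polys_below (degree q) \<Longrightarrow> \<mu> f = Fin 0" "0 \<le> \<gamma>"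
  shows "mu' \<mu> q \<gamma> f = Fin 0"
proof -
  let ?F = "q_expansion q f"
  have coeff: "\<mu> (coeff ?F i) = Fin 0" for i
    using is_q_expansion_q_expansion[OF assms(1), of f] assms(2) by (auto simp: is_q_expansion_def)
  show ?thesis
    unfolding mu'_def coeff
  proof (rule Min_eqI)
    show "Fin 0 \<in> (\<lambda>i. Fin 0 + Fin (\<Sum>j<i. \<gamma>)) ` {..degree ?F}"
      by (rule image_eqI[of _ _ 0]) auto
  qed (use assms(3) in \<open>auto intro: sum_nonneg\<close>)
qed

theorem theorem1p1:
  fixes n :: nat
    and \<Gamma> :: "'g::linordered_ab_group_add set"
    and \<gamma> :: 'g
    and S :: "'k::field poly set"
    and q :: "'k poly"
    and \<mu> :: "'k poly \<Rightarrow> 'g with_infty"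
  assumes "n \<ge> 1"
    and "add_subgroup \<Gamma>"
    and "\<forall>f\<in>S. \<forall>g\<in>S. f * g \<in> S"
    and "polys_below n \<subseteq> S"
    and "degree q = n"
    and "\<forall>f\<in>S. \<mu> f \<in> adjoin_infty \<Gamma>"
    and "V2 S \<mu>"
    and "\<forall>f\<in>polys_below n. \<forall>g\<in>polys_below n. \<mu> (f * g) = \<mu> f + \<mu> g"
    and "\<forall>f\<in>polys_below n. \<forall>g\<in>polys_below n. f \<noteq> 0 \<longrightarrow> g \<noteq> 0 \<longrightarrow>
           (\<forall>a. \<forall>c\<in>polys_below n. f * g = a * q + c \<longrightarrow>
              \<mu> c = \<mu> (f * g) \<and> \<mu> (f * g) < \<mu> a + Fin \<gamma>)"
  shows "V1 UNIV (mu' \<mu> q \<gamma>) \<and> V2 UNIV (mu' \<mu> q \<gamma>)"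
proof -
  let ?B = "polys_below (degree q)"
  have q: "degree q > 0" using assms(1,5) by simp
  have B01: "0 \<in> ?B" "1 \<in> ?B" using q by (auto simp: polys_below_def)
  have mult: "\<mu> (f * g) = \<mu> f + \<mu> g" if "f \<in> ?B" "g \<in> ?B" for f g
    using assms(5,8) that by auto
  have ii: "\<mu> (f * g mod q) = \<mu> (f * g) \<and> \<mu> (f * g) < \<mu> (f * g div q) + Fin \<gamma>"
    if "f \<in> ?B" "g \<in> ?B" "f \<noteq> 0" "g \<noteq> 0" for f g
  proof -
    have "f * g = (f * g div q) * q + f * g mod q" by simp
    then show ?thesis
      using assms(5,9) that mod_mem_polys_below[OF q, of "f * g"] by blast
  qed
  show ?thesis
  proof (cases "\<mu> 0")
    case Infty
    interpret partial_valuation \<mu> q \<gamma>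
    proof
      fix f g :: "'k poly" assume fg: "f \<in> ?B" "g \<in> ?B"
      show "min (\<mu> f) (\<mu> g) \<le> \<mu> (f + g)"
        using assms(4,5,7) fg polys_below_add[OF fg] by (auto simp: V2_def)
      show "\<mu> (f * g mod q) = \<mu> (f * g)"
        using ii[OF fg] by (cases "f = 0 \<or> g = 0") auto
    qed (use q Infty mult ii in auto)
    show ?thesis using V1_mu' V2_mu' by blast
  next
    case (Fin z)
    \<comment> \<open>Since \<open>0 = 0 \<cdot> f\<close>, a finite value of \<open>0\<close> can be cancelled from \<open>\<mu>(0) = \<mu>(0) + \<mu>(f)\<close>.\<close>
    have zero: "\<mu> f = Fin 0" if "f \<in> ?B" for f
      using mult[OF B01(1) that] Fin by (cases "\<mu> f") auto
    have "\<mu> (1 * 1) < \<mu> (1 * 1 div q) + Fin \<gamma>"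
      using ii[OF B01(2) B01(2)] by simp
    moreover have "1 div q = 0"
      using q by (simp add: div_poly_less)
    ultimately have "0 < \<gamma>"
      using zero[OF B01(1)] zero[OF B01(2)] by simp
    then have "mu' \<mu> q \<gamma> f = Fin 0" for f
      using mu'_eq_zero[where \<mu> = \<mu>, OF q zero] by simp
    then show ?thesis by (simp add: V1_def V2_def)
  qed
qed

end
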